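(* Let $X$ be a Tychonoff space satisfying at least one of the following conditions: (i) $X$ is totally countably compact; (ii) $X$ is near sequentially compact. Then $X$ is a sequentially Ascoli space.
   Context: A space $X$ is totally countably compact if every sequence in $X$ has a subsequence with compact closure. It is near sequentially compact if for any sequence $(U_n)_{n\in\omega}$ of (nonempty) open sets in $X$ there exists a sequence $(x_n)_{n\in\omega}\in\prod_{n\in\omega}U_n$ containing a convergent subsequence $(x_{n_k})_{k\in\omega}$. A Tychonoff space $X$ is sequentially Ascoli if every convergent sequence $S$ in $C_k(X)$ (the space of continuous real-valued functions on $X$ with the compact-open topology) is equicontinuous, i.e. for every $x\in X$ and $\varepsilon>0$ there is a neighborhood $O$ of $x$ with $|f(t)-f(x)|<\varepsilon$ for all $t\in O$ and $f\in S$. *)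

theory Defs
  imports "HOL-Analysis.Analysis"
begin

definition tychonoff_space :: "'a topology \<Rightarrow> bool" where
  "tychonoff_space X \<longleftrightarrow> completely_regular_space X \<and> Hausdorff_space X"

definition totally_countably_compact_space :: "'a topology \<Rightarrow> bool" where
  "totally_countably_compact_space X \<longleftrightarrow>
     (\<forall>x :: nat \<Rightarrow> 'a. range x \<subseteq> topspace X \<longrightarrow>
        (\<exists>r :: nat \<Rightarrow> nat. strict_mono r \<and> compactin X (X closure_of range (x \<circ> r))))"

definition near_sequentially_compact_space :: "'a topology \<Rightarrow> bool" where
  "near_sequentially_compact_space X \<longleftrightarrow>
     (\<forall>U :: nat \<Rightarrow> 'a set. (\<forall>n. openin X (U n) \<and> U n \<noteq> {}) \<longrightarrow>
        (\<exists>x. (\<forall>n. x n \<in> U n) \<and>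
          (\<exists>(r :: nat \<Rightarrow> nat) l. strict_mono r \<and> limitin X (x \<circ> r) l sequentially)))"

text \<open>Continuous maps are taken to be \<open>undefined\<close> off the carrier, so that each continuous
  function on the space is represented by exactly one HOL function.\<close>

definition continuous_real_functions :: "'a topology \<Rightarrow> ('a \<Rightarrow> real) set" where
  "continuous_real_functions X =
     {f \<in> extensional (topspace X). continuous_map X euclideanreal f}"

definition C_k :: "'a topology \<Rightarrow> ('a \<Rightarrow> real) topology" where
  "C_k X = topology_generated_by
     {{f \<in> continuous_real_functions X. f ` K \<subseteq> V} | K V. compactin X K \<and> open V}"

lemma topspace_C_k [simp]: "topspace (C_k X) = continuous_real_functions X"
proof -
  have "\<exists>K V. continuous_real_functions X = {f \<in> continuous_real_functions X. f ` K \<subseteq> V}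
          \<and> compactin X K \<and> open V"
    by (rule exI[of _ "{}"], rule exI[of _ UNIV]) auto
  then show ?thesis
    unfolding C_k_def topology_generated_by_topspace by blast
qed

definition equicontinuous_family :: "'a topology \<Rightarrow> ('a \<Rightarrow> real) set \<Rightarrow> bool" where
  "equicontinuous_family X S \<longleftrightarrow>
     (\<forall>x \<in> topspace X. \<forall>\<epsilon>>0. \<exists>U. openin X U \<and> x \<in> U \<and>
        (\<forall>t \<in> U. \<forall>f \<in> S. \<bar>f t - f x\<bar> < \<epsilon>))"

text \<open>The explicit range condition is needed because \<open>limitin\<close> constrains
  only the eventual terms of a sequence.\<close>

definition sequentially_Ascoli_space :: "'a topology \<Rightarrow> bool" where
  "sequentially_Ascoli_space X \<longleftrightarrow> tychonoff_space X \<and>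
     (\<forall>f :: nat \<Rightarrow> 'a \<Rightarrow> real.
        range f \<subseteq> topspace (C_k X) \<and> (\<exists>g. limitin (C_k X) f g sequentially) \<longrightarrow>
        equicontinuous_family X (range f))"

end

theory Submission
  imports Defs
begin

text \<open>In either case every sequence of nonempty open sets admits a selection with a subsequence
  contained in a compact set. Applied to the open sets where \<open>\<bar>f n - g\<bar> > e\<close>, this shows that a
  sequence \<open>f\<close> converging to \<open>g\<close> in \<open>C_k X\<close> converges uniformly on all of \<open>X\<close>, and uniformly
  convergent sequences of continuous functions are equicontinuous.\<close>

text \<open>A subbasic set of \<open>C_k X\<close> confines the image of one compact set to one open
  set. So \<open>K\<close> is cut into finitely many compact pieces on which \<open>g\<close> is
  nearly constant, and each piece gives one subbasic neighbourhood of \<open>g\<close>.\<close>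

lemma C_k_limit_uniform_on_compact:
  assumes lim: "limitin (C_k X) f g sequentially" and K: "compactin X K" and e: "e > 0"
  shows "\<forall>\<^sub>F n in sequentially. \<forall>t\<in>K. \<bar>f n t - g t\<bar> < e"
proof -
  have gX: "g \<in> continuous_real_functions X"
    using lim limitin_topspace by fastforce
  then have cont_g: "continuous_map X euclideanreal g"
    by (simp add: continuous_real_functions_def)
  have "compact (g ` K)"
    using image_compactin[OF K cont_g] by simp
  moreover have "g ` K \<subseteq> (\<Union>c\<in>g ` K. ball c (e/3))"
    using e by force
  ultimately obtain C where C: "C \<subseteq> g ` K" "finite C" "g ` K \<subseteq> (\<Union>c\<in>C. ball c (e/3))"
    using compactE_image[of "g ` K" "g ` K" "\<lambda>c. ball c (e/3)"] by auto
  \<comment> \<open>The closed ball makes each piece compact. Its radius \<open>e/3\<close> lies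
    below \<open>e/2\<close>, so \<open>g\<close> itself belongs to the subbasic set used next, and
    \<open>e/2 + e/3 < e\<close> gives the final estimate.\<close>
  define L where "L c = {t \<in> topspace X. g t \<in> cball c (e/3)} \<inter> K" for c
  have "compactin X (L c)" for c
    unfolding L_def
    by (intro closed_Int_compactin closedin_continuous_map_preimage[OF cont_g] K) auto
  then have "openin (C_k X) {h \<in> continuous_real_functions X. h ` L c \<subseteq> ball c (e/2)}" for c
    unfolding C_k_def by (intro topology_generated_by_Basis) blast
  moreover have "g ` L c \<subseteq> ball c (e/2)" for c
    using e by (auto simp: L_def)
  ultimately have "\<forall>\<^sub>F n in sequentially. f n ` L c \<subseteq> ball c (e/2)" for c
    using lim gX unfolding limitin_def by (fastforce elim: eventually_mono)
  then have "\<forall>\<^sub>F n in sequentially. \<forall>c\<in>C. f n ` L c \<subseteq> ball c (e/2)"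
    using C(2) by (simp add: eventually_ball_finite)
  then show ?thesis
  proof (rule eventually_mono, intro ballI)
    fix n t
    assume n: "\<forall>c\<in>C. f n ` L c \<subseteq> ball c (e/2)" and t: "t \<in> K"
    obtain c where c: "c \<in> C" "dist c (g t) < e/3"
      using C(3) t by fastforce
    then have "t \<in> L c"
      using t compactin_subset_topspace[OF K] by (auto simp: L_def)
    then have "dist c (f n t) < e/2"
      using n c(1) by fastforce
    with c(2) e show "\<bar>f n t - g t\<bar> < e"
      unfolding dist_real_def by arith
  qed
qed

text \<open>Under total countable compactness any selection works, with \<open>K\<close> the closure
  of a subsequence. Under near sequential compactness the selection comes with a convergent
  subsequence, and \<open>K\<close> is that subsequence together with its limit.\<close>

lemma open_selection_in_compact:
  assumes X: "totally_countably_compact_space X \<or> near_sequentially_compact_space X"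
    and U: "\<And>n. openin X (U n)" "\<And>n. U n \<noteq> {}"
  obtains x K and r :: "nat \<Rightarrow> nat"
  where "\<And>n. x n \<in> U n" "strict_mono r" "compactin X K" "\<And>n. x (r n) \<in> K"
  using X
proof
  assume tcc: "totally_countably_compact_space X"
  define x where "x n = (SOME y. y \<in> U n)" for n
  have x: "x n \<in> U n" for n
    using U(2) by (simp add: x_def some_in_eq)
  then have xX: "range x \<subseteq> topspace X"
    using U(1) openin_subset by blast
  then obtain r :: "nat \<Rightarrow> nat"
    where r: "strict_mono r" "compactin X (X closure_of range (x \<circ> r))"
    using tcc unfolding totally_countably_compact_space_def by blast
  have "range (x \<circ> r) \<subseteq> X closure_of range (x \<circ> r)"
    using xX by (intro closure_of_subset) auto
  then show thesis
    using that x r by fastforce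
next
  assume "near_sequentially_compact_space X"
  then obtain x l and r :: "nat \<Rightarrow> nat"
    where x: "\<And>n. x n \<in> U n" and r: "strict_mono r" "limitin X (x \<circ> r) l sequentially"
    using U unfolding near_sequentially_compact_space_def by metis
  have "range (x \<circ> r) \<subseteq> topspace X"
    using x U(1) openin_subset by fastforce
  then have "compactin X (insert l (range (x \<circ> r)))"
    using compactin_sequence_with_limit[OF r(2)] by simp
  then show thesis
    using that x r(1) by fastforce
qed

lemma C_k_limit_uniform:
  assumes X: "totally_countably_compact_space X \<or> near_sequentially_compact_space X"
    and f: "\<And>n. continuous_map X euclideanreal (f n)"
    and lim: "limitin (C_k X) f g sequentially" and e: "e > 0"
  shows "\<forall>\<^sub>F n in sequentially. \<forall>t\<in>topspace X. \<bar>f n t - g t\<bar> \<le> e"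
proof (rule ccontr)
  assume "\<not> ?thesis"
  then obtain s :: "nat \<Rightarrow> nat"
    where s: "strict_mono s" "\<And>n. \<not> (\<forall>t\<in>topspace X. \<bar>f (s n) t - g t\<bar> \<le> e)"
    by (auto dest: not_eventually_sequentiallyD)
  \<comment> \<open>Failure of a bound by \<le> is a strict inequality, hence an open condition.
    Passing to \<open>s\<close> keeps only indices where the bound fails, so every
    \<open>U n\<close> is nonempty.\<close>
  define U where "U n = {t \<in> topspace X. \<bar>f (s n) t - g t\<bar> \<in> {e<..}}" for n
  have "continuous_map X euclideanreal g"
    using lim limitin_topspace by (fastforce simp: continuous_real_functions_def)
  then have "openin X (U n)" for n
    unfolding U_def
    by (intro openin_continuous_map_preimage[where Y = euclideanreal]
        continuous_map_real_abs continuous_map_diff f) auto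
  moreover have "U n \<noteq> {}" for n
    using s(2)[of n] by (auto simp: U_def)
  ultimately obtain x K and r :: "nat \<Rightarrow> nat" where
    x: "\<And>n. x n \<in> U n" "strict_mono r" "compactin X K" "\<And>n. x (r n) \<in> K"
    using open_selection_in_compact[OF X] by metis
  \<comment> \<open>The point \<open>x (r n)\<close> lies in \<open>U (r n)\<close>, which concerns
    \<open>f (s (r n))\<close>, so the uniform convergence on \<open>K\<close> is needed along
    \<open>s \<circ> r\<close>.\<close>
  have "strict_mono (s \<circ> r)"
    using s(1) x(2) by (rule strict_mono_o)
  then have "\<forall>\<^sub>F n in sequentially. \<forall>t\<in>K. \<bar>f ((s \<circ> r) n) t - g t\<bar> < e"
    using C_k_limit_uniform_on_compact[OF lim x(3) e] eventually_subseq by blast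
  then obtain n where "\<bar>f (s (r n)) (x (r n)) - g (x (r n))\<bar> < e"
    using x(4) by (auto simp: eventually_sequentially)
  then show False
    using x(1)[of "r n"] by (simp add: U_def)
qed

text \<open>From some \<open>N\<close> on, continuity of \<open>g\<close> serves all terms at once
  by a three-term \<open>e/3\<close> estimate; the finitely many earlier terms use their own
  continuity.\<close>

lemma equicontinuous_family_uniform_limit:
  fixes f :: "nat \<Rightarrow> 'a \<Rightarrow> real"
  assumes f: "\<And>n. continuous_map X euclideanreal (f n)"
    and g: "continuous_map X euclideanreal g"
    and unif: "\<And>e. e > 0 \<Longrightarrow> \<forall>\<^sub>F n in sequentially. \<forall>t\<in>topspace X. \<bar>f n t - g t\<bar> \<le> e"
  shows "equicontinuous_family X (range f)"
  unfolding equicontinuous_family_def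
proof (intro ballI allI impI)
  fix x and e :: real
  assume x: "x \<in> topspace X" and e: "e > 0"
  obtain N where N: "\<And>n t. n \<ge> N \<Longrightarrow> t \<in> topspace X \<Longrightarrow> \<bar>f n t - g t\<bar> \<le> e/3"
    using unif[of "e/3"] e by (auto simp: eventually_sequentially)
  define W where "W h = {t \<in> topspace X. h t \<in> ball (h x) (e/3)}" for h :: "'a \<Rightarrow> real"
  have W: "openin X (W h)" "x \<in> W h" if "continuous_map X euclideanreal h" for h
    using openin_continuous_map_preimage[OF that, of "ball (h x) (e/3)"] x e
    by (auto simp: W_def)
  \<comment> \<open>A finite intersection, hence open; the presence of \<open>g\<close> keeps the
    index set nonempty even if \<open>N = 0\<close>.\<close>
  let ?U = "\<Inter>h\<in>insert g (f ` {..<N}). W h"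
  have "openin X ?U"
    using W(1) f g by (intro openin_INT2) auto
  moreover have "x \<in> ?U"
    using W(2) f g by blast
  moreover have "\<bar>f n t - f n x\<bar> < e" if t: "t \<in> ?U" for n t
  proof (cases "n < N")
    case True
    with t have "t \<in> W (f n)" by blast
    then have "\<bar>f n x - f n t\<bar> < e/3" by (simp add: W_def dist_real_def)
    with e show ?thesis by linarith
  next
    case False
    have "t \<in> W g" using t by blast
    then have "t \<in> topspace X" "\<bar>g x - g t\<bar> < e/3"
      by (auto simp: W_def dist_real_def)
    moreover from this have "\<bar>f n t - g t\<bar> \<le> e/3" "\<bar>f n x - g x\<bar> \<le> e/3"
      using False N x by auto
    ultimately show ?thesis by linarith
  qed
  ultimately show "\<exists>U. openin X U \<and> x \<in> U \<and> (\<forall>t\<in>U. \<forall>h\<in>range f. \<bar>h t - h x\<bar> < e)"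
    by blast
qed

theorem theorem3p2:
  fixes X :: "'a topology"
  assumes "tychonoff_space X"
    and "totally_countably_compact_space X \<or> near_sequentially_compact_space X"
  shows "sequentially_Ascoli_space X"
  unfolding sequentially_Ascoli_space_def
proof (intro conjI allI impI)
  fix f :: "nat \<Rightarrow> 'a \<Rightarrow> real"
  assume A: "range f \<subseteq> topspace (C_k X) \<and> (\<exists>g. limitin (C_k X) f g sequentially)"
  then obtain g where g: "limitin (C_k X) f g sequentially" by blast
  \<comment> \<open>Equicontinuity concerns every term, whereas convergence controls only late ones;
    the range condition covers the rest.\<close>
  have f: "continuous_map X euclideanreal (f n)" for n
    using A by (auto simp: continuous_real_functions_def)
  have "continuous_map X euclideanreal g"
    using g limitin_topspace by (fastforce simp: continuous_real_functions_def)
  then show "equicontinuous_family X (range f)"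
    using C_k_limit_uniform[OF assms(2) f g] f
    by (intro equicontinuous_family_uniform_limit[where g = g]) auto
qed (rule assms(1))

end
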